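(* Let $r_n:=|\mathfrak{A}_{2n+1}(2413,3142)|$, $R(x):=\sum_{n\ge1}r_nx^n$, $t_n:=|\mathfrak{A}_{2n}(2413,3142)|$ for $n\ge1$, and $T(x):=\sum_{n\ge1}t_nx^n$. Then $$\tfrac12R(x)=\tfrac12R(x)T(x)+T(x).$$ Consequently $t_1=1$ and for $n\ge2$, $$t_n=\frac{4}{n-1}\sum_{i=0}^{n-2}2^i\binom{2n-1}{i}\binom{n-1}{i+1}.$$
   Context: $\mathfrak{A}_m(2413,3142)$ is the set of permutations $\pi$ of $[m]$ that are alternating (up-down), i.e. $\pi(1)<\pi(2)>\pi(3)<\pi(4)>\cdots$, and avoid both classical patterns $2413$ and $3142$. *)

theory Defs
  imports "HOL-Combinatorics.Permutations" "HOL-Computational_Algebra.Formal_Power_Series"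
begin

definition alternating :: "nat \<Rightarrow> (nat \<Rightarrow> nat) \<Rightarrow> bool" where
  "alternating m \<pi> \<longleftrightarrow>
     (\<forall>i. 1 \<le> i \<and> i < m \<longrightarrow>
        (odd i \<longrightarrow> \<pi> i < \<pi> (Suc i)) \<and> (even i \<longrightarrow> \<pi> i > \<pi> (Suc i)))"

definition contains_pattern :: "nat \<Rightarrow> (nat \<Rightarrow> nat) \<Rightarrow> nat list \<Rightarrow> bool" where
  "contains_pattern m \<pi> p \<longleftrightarrow>
     (\<exists>idx :: nat \<Rightarrow> nat.
        (\<forall>a < length p. 1 \<le> idx a \<and> idx a \<le> m) \<and>
        (\<forall>a b. a < b \<and> b < length p \<longrightarrow> idx a < idx b) \<and>
        (\<forall>a b. a < length p \<and> b < length p \<longrightarrow> (\<pi> (idx a) < \<pi> (idx b) \<longleftrightarrow> p ! a < p ! b)))"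

definition alt_avoid_set :: "nat \<Rightarrow> (nat \<Rightarrow> nat) set" where
  "alt_avoid_set m = {\<pi>. \<pi> permutes {1..m} \<and> alternating m \<pi>
      \<and> \<not> contains_pattern m \<pi> [2,4,1,3] \<and> \<not> contains_pattern m \<pi> [3,1,4,2]}"

definition r_seq :: "nat \<Rightarrow> nat" where
  "r_seq n = card (alt_avoid_set (2*n+1))"

definition t_seq :: "nat \<Rightarrow> nat" where
  "t_seq n = card (alt_avoid_set (2*n))"

definition R_fps :: "rat fps" where
  "R_fps = Abs_fps (\<lambda>n. if n = 0 then 0 else of_nat (r_seq n))"

definition T_fps :: "rat fps" where
  "T_fps = Abs_fps (\<lambda>n. if n = 0 then 0 else of_nat (t_seq n))"

end

theory Submission
  imports Defs
begin

text \<open>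
  A permutation of size at least 2 avoiding 2413 and 3142 is either a direct sum or a skew sum, but not
  both, and it splits uniquely into its first indecomposable summand and the rest. An up-down permutation
  ascends only after odd positions and descends only after even ones; hence the first summand of a direct
  sum has odd length and is followed by a down-up permutation, and the first summand of a skew sum has
  even length and is followed by an up-down one. Complementation exchanges up-down with down-up and sums
  with skew sums. With \<open>S = 1 + R\<close>, and \<open>P\<close>, \<open>M\<close> counting the sum and skew decomposable permutations of
  odd (\<open>o\<close>) and even (\<open>e\<close>) length, this gives
  \<open>P\<^sub>e = x (S - P\<^sub>o) S\<close>, \<open>P\<^sub>o = (S - P\<^sub>o) T\<close>, \<open>M\<^sub>e = (T - M\<^sub>e) T\<close>, \<open>M\<^sub>o = (T - M\<^sub>e) S\<close>,
  \<open>T = P\<^sub>e + M\<^sub>e\<close> and \<open>S = 1 + P\<^sub>o + M\<^sub>o\<close>. Elimination yields \<open>S (1 - T) = 1 + T\<close> and \<open>T = x S\<^sup>2\<close>, so that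
  \<open>T = x ((1 + T) / (1 - T))\<^sup>2\<close>, and Lagrange inversion extracts the coefficients.
\<close>

subsection \<open>Lagrange inversion\<close>

context includes fps_syntax begin

text \<open>As \<open>c\<close> has no constant term, \<open>c ^ i\<close> starts in degree
  \<open>i\<close> or later; hence all coefficients of the composition up to degree \<open>n\<close>
  can be summed over the same range \<open>0..n\<close>, and the two sums swap.\<close>

lemma fps_compose_mult_nth:
  fixes a b c :: "'a::comm_ring_1 fps"
  assumes "c $ 0 = 0"
  shows "((a oo c) * b) $ n = (\<Sum>i=0..n. a $ i * (c ^ i * b) $ n)"
proof -
  have ext: "(a oo c) $ k = (\<Sum>i=0..n. a $ i * c ^ i $ k)" if "k \<le> n" for k
    unfolding fps_compose_nth
    by (rule sum.mono_neutral_left) (use that startsby_zero_power_prefix[OF assms] in auto)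
  have "((a oo c) * b) $ n = (\<Sum>k=0..n. \<Sum>i=0..n. a $ i * c ^ i $ k * b $ (n - k))"
    unfolding fps_mult_nth by (rule sum.cong) (auto simp: ext sum_distrib_right)
  also have "\<dots> = (\<Sum>i=0..n. \<Sum>k=0..n. a $ i * c ^ i $ k * b $ (n - k))"
    by (rule sum.swap)
  also have "\<dots> = (\<Sum>i=0..n. a $ i * (c ^ i * b) $ n)"
    by (simp add: fps_mult_nth sum_distrib_left mult.assoc)
  finally show ?thesis .
qed

text \<open>\<open>T\<close> is the compositional inverse of \<open>\<psi>\<close>, which is X /
  \<phi>. Expanding \<open>fps_deriv T oo \<psi>\<close> in powers of \<open>\<psi>\<close> and
  multiplying by \<open>fps_deriv \<psi> * \<phi> ^ Suc n\<close> isolates one coefficient of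
  \<open>fps_deriv T\<close>; powers of \<open>\<phi>\<close> stand in for the negative powers of
  \<open>\<psi>\<close> in the classical residue argument.\<close>

theorem fps_Lagrange_inversion:
  fixes \<phi> T :: "'a::field_char_0 fps"
  assumes \<phi>0: "\<phi> $ 0 \<noteq> 0" and T0: "T $ 0 = 0" and T: "T = fps_X * (\<phi> oo T)"
  shows "of_nat (Suc n) * T $ Suc n = (\<phi> ^ Suc n) $ n"
proof -
  define g where "g = inverse \<phi>"
  define \<psi> where "\<psi> = fps_X * g"
  have g\<phi>: "g * \<phi> = 1" using \<phi>0 by (simp add: g_def inverse_mult_eq_1)
  have \<psi>0: "\<psi> $ 0 = 0" by (simp add: \<psi>_def)
  have T1: "T $ 1 \<noteq> 0" using \<phi>0 by (subst T) simp
  have "\<psi> oo T = T * (g oo T)"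
    by (simp add: \<psi>_def fps_compose_mult_distrib T0)
  also have "\<dots> = fps_X * ((g * \<phi>) oo T)"
    by (subst (1) T) (simp add: fps_compose_mult_distrib T0 mult_ac)
  finally have "\<psi> oo T = fps_X" by (simp add: g\<phi>)
  \<comment> \<open>A right inverse of \<open>\<psi>\<close> is also a left inverse:
    \<open>T\<close> cancels on the right because its linear coefficient is nonzero.\<close>
  then have "T oo \<psi> oo T = fps_X oo T"
    by (simp add: T0 \<psi>0 flip: fps_compose_assoc)
  then have "T oo \<psi> = fps_X"
    using fps_compose_inj_right[OF T0 T1] by blast
  then have deriv: "(fps_deriv T oo \<psi>) * fps_deriv \<psi> = 1"
    using fps_compose_deriv[OF \<psi>0, of T] by simp
  have d\<psi>: "\<phi> * fps_deriv \<psi> = 1 - fps_X * fps_deriv \<phi> * g"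
  proof -
    have eq: "fps_deriv \<psi> = g - fps_X * fps_deriv \<phi> * g * g"
      using fps_inverse_deriv[OF \<phi>0] by (simp add: \<psi>_def g_def power2_eq_square mult_ac)
    have "\<phi> * fps_deriv \<psi> = g * \<phi> - fps_X * fps_deriv \<phi> * g * (g * \<phi>)"
      unfolding eq by (simp only: right_diff_distrib mult_ac)
    then show ?thesis by (simp add: g\<phi>)
  qed
  \<comment> \<open>The power series form of: the residue of \<open>\<psi>' / \<psi>\<^sup>j\<^sup>+\<^sup>1\<close> vanishes unless \<open>j = 0\<close>.\<close>
  have residue: "(\<phi> ^ Suc j * fps_deriv \<psi>) $ j = (if j = 0 then 1 else 0)" for j
  proof (cases j)
    case 0
    then show ?thesis by (simp add: d\<psi>)
  next
    case (Suc k)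
    have "\<phi> ^ Suc j * fps_deriv \<psi> = \<phi> ^ j * (\<phi> * fps_deriv \<psi>)" by (simp add: mult_ac)
    also have "\<dots> = \<phi> ^ j - fps_X * fps_deriv \<phi> * \<phi> ^ k * (g * \<phi>)"
      by (simp add: d\<psi> Suc algebra_simps)
    finally have eq: "\<phi> ^ Suc j * fps_deriv \<psi> = \<phi> ^ j - fps_X * fps_deriv \<phi> * \<phi> ^ k"
      by (simp add: g\<phi>)
    \<comment> \<open>With F = \<open>\<phi> ^ j\<close> the right-hand side is j F - X F', whose
      coefficient in degree j vanishes for every series F.\<close>
    have "of_nat j * (\<phi> ^ Suc j * fps_deriv \<psi>) = of_nat j * \<phi> ^ j - fps_X * fps_deriv (\<phi> ^ j)"
      unfolding fps_deriv_power' eq by (simp add: Suc right_diff_distrib mult_ac del: of_nat_Suc power_Suc)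
    then have "(of_nat j * (\<phi> ^ Suc j * fps_deriv \<psi>)) $ j = (of_nat j * \<phi> ^ j - fps_X * fps_deriv (\<phi> ^ j)) $ j"
      by simp
    then have "of_nat j * (\<phi> ^ Suc j * fps_deriv \<psi>) $ j = 0"
      unfolding fps_of_nat[symmetric] fps_sub_nth fps_mult_left_const_nth
      by (simp add: Suc del: of_nat_Suc power_Suc)
    then show ?thesis using Suc by (simp del: of_nat_Suc power_Suc)
  qed
  \<comment> \<open>Since \<open>\<psi> ^ i * \<phi> ^ i\<close> is \<open>fps_X ^ i\<close>, what
    remains is the residue with index \<open>n - i\<close>.\<close>
  have coeff: "(\<psi> ^ i * (fps_deriv \<psi> * \<phi> ^ Suc n)) $ n = (if i = n then 1 else 0)" if "i \<le> n" for i
  proof -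
    have "\<phi> ^ Suc n = \<phi> ^ i * \<phi> ^ Suc (n - i)"
      using that by (metis Suc_diff_le le_add_diff_inverse le_SucI power_add)
    then have "\<psi> ^ i * (fps_deriv \<psi> * \<phi> ^ Suc n) = fps_X ^ i * (g * \<phi>) ^ i * (\<phi> ^ Suc (n - i) * fps_deriv \<psi>)"
      by (simp only: \<psi>_def power_mult_distrib mult_ac)
    then have "(\<psi> ^ i * (fps_deriv \<psi> * \<phi> ^ Suc n)) $ n = (\<phi> ^ Suc (n - i) * fps_deriv \<psi>) $ (n - i)"
      using that by (simp only: g\<phi> fps_X_power_mult_nth power_one mult_1_right not_less if_False if_True) simp
    then show ?thesis using that by (simp add: residue del: power_Suc)
  qed
  have "(\<phi> ^ Suc n) $ n = ((fps_deriv T oo \<psi>) * fps_deriv \<psi> * \<phi> ^ Suc n) $ n"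
    unfolding deriv by simp
  also have "\<dots> = (\<Sum>i=0..n. fps_deriv T $ i * (\<psi> ^ i * (fps_deriv \<psi> * \<phi> ^ Suc n)) $ n)"
    unfolding mult.assoc by (rule fps_compose_mult_nth[OF \<psi>0])
  also have "\<dots> = (\<Sum>i=0..n. if i = n then fps_deriv T $ n else 0)"
    by (rule sum.cong) (auto simp: coeff simp del: power_Suc)
  also have "\<dots> = of_nat (Suc n) * T $ Suc n"
    by (simp add: sum.delta)
  finally show ?thesis by simp
qed

section \<open>Powers of (1 + x) / (1 - x) and the explicit coefficients\<close>

text \<open>The fraction equals 1 + 2x / (1 - x). The binomial theorem and the coefficients of (1 -
  x)^(-j) give the sum, with j = i + 1.\<close>

lemma fps_cayley_power_nth:
  fixes N m :: nat
  shows "(((1 + fps_X) / (1 - fps_X)) ^ N :: 'a::field_char_0 fps) $ Suc m =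
    (\<Sum>i=0..m. of_nat (N choose Suc i) * 2 ^ Suc i * of_nat (m choose i))"
proof -
  define h :: "'a fps" where "h = inverse (1 - fps_X)"
  have h: "(1 - fps_X) * h = 1" unfolding h_def by (rule inverse_mult_eq_1') simp
  have "(1 + fps_X) / (1 - fps_X) = (1 + fps_X) * h"
    unfolding h_def by (rule fps_divide_unit) simp
  also have "\<dots> = (1 - fps_X) * h + 2 * fps_X * h" by (simp add: algebra_simps)
  finally have "(1 + fps_X) / (1 - fps_X) = 2 * fps_X * h + 1" by (simp add: h)
  then have "((1 + fps_X) / (1 - fps_X)) ^ N = (\<Sum>j\<le>N. of_nat (N choose j) * (2 * fps_X * h) ^ j)"
    by (simp add: binomial_ring)
  also have "\<dots> $ Suc m = (\<Sum>j\<le>N. of_nat (N choose j) * 2 ^ j * (if j \<le> Suc m then h ^ j $ (Suc m - j) else 0))"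
  proof -
    have "of_nat (N choose j) * (2 * fps_X * h) ^ j =
        fps_const (of_nat (N choose j) * 2 ^ j) * (fps_X ^ j * h ^ j)" for j
      by (simp add: power_mult_distrib mult_ac fps_of_nat flip: fps_const_mult fps_const_power fps_numeral_fps_const)
    then show ?thesis
      unfolding fps_sum_nth by (intro sum.cong) (auto simp: fps_X_power_mult_nth)
  qed
  \<comment> \<open>The term j = 0 drops out because the degree \<open>Suc m\<close> is positive;
    terms with j > N have a zero binomial coefficient.\<close>
  also have "\<dots> = (\<Sum>j\<in>{1..Suc m}. of_nat (N choose j) * 2 ^ j * h ^ j $ (Suc m - j))"
    by (rule sum.mono_neutral_cong) (auto simp: binomial_eq_0 not_le Suc_le_eq)
  also have "\<dots> = (\<Sum>i=0..m. of_nat (N choose Suc i) * 2 ^ Suc i * h ^ Suc i $ (m - i))"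
    unfolding sum.atLeast_Suc_atMost_Suc_shift One_nat_def by simp
  also have "\<dots> = (\<Sum>i=0..m. of_nat (N choose Suc i) * 2 ^ Suc i * of_nat (m choose i))"
  proof (rule sum.cong[OF refl])
    fix i assume "i \<in> {0..m}"
    then have "i \<le> m" by simp
    have "h ^ Suc i = inverse ((1 - fps_const 1 * fps_X) ^ Suc i)"
      by (simp add: h_def fps_inverse_power del: power_Suc)
    also have "\<dots> = Abs_fps (\<lambda>k. of_nat ((Suc i + k - 1) choose k) * 1 ^ k)"
      by (rule one_minus_const_fps_X_neg_power') simp
    finally have "h ^ Suc i $ (m - i) = of_nat (m choose (m - i))"
      using \<open>i \<le> m\<close> by simp
    then show "of_nat (N choose Suc i) * 2 ^ Suc i * h ^ Suc i $ (m - i) =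
        of_nat (N choose Suc i) * 2 ^ Suc i * (of_nat (m choose i) :: 'a)"
      using \<open>i \<le> m\<close> by (simp add: binomial_symmetric[of i m])
  qed
  finally show ?thesis .
qed

text \<open>The first equation solves to S = (1 + T) / (1 - T), so T = x \<phi>(T) for \<phi> the
  square of (1 + x) / (1 - x), and Lagrange inversion applies.\<close>

lemma fps_cayley_square_fixpoint_nth:
  fixes S T :: "'a::field_char_0 fps"
  assumes T0: "T $ 0 = 0" and S: "S * (1 - T) = 1 + T" and T: "T = fps_X * S ^ 2"
  shows "T $ Suc (Suc m) = 4 / of_nat (Suc m) *
    (\<Sum>i=0..m. 2 ^ i * of_nat ((2 * m + 3) choose i) * of_nat (Suc m choose Suc i))"
proof -
  define \<phi> :: "'a fps" where "\<phi> = ((1 + fps_X) / (1 - fps_X)) ^ 2"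
  have "(1 + fps_X) / (1 - fps_X) oo T = (1 + T) / (1 - T)"
    by (simp add: fps_divide_unit fps_compose_mult_distrib fps_inverse_compose
        fps_compose_add_distrib fps_compose_sub_distrib T0)
  also have "\<dots> = S * ((1 - T) * inverse (1 - T))"
    using S T0 by (simp add: fps_divide_unit mult.assoc[symmetric])
  also have "\<dots> = S" using T0 by (simp add: inverse_mult_eq_1')
  finally have "\<phi> oo T = S ^ 2"
    unfolding \<phi>_def by (simp add: fps_compose_power[OF T0, symmetric])
  then have "T = fps_X * (\<phi> oo T)" using T by simp
  moreover have "\<phi> $ 0 \<noteq> 0" by (simp add: \<phi>_def fps_divide_unit power2_eq_square)
  ultimately have "of_nat (Suc (Suc m)) * T $ Suc (Suc m) = (\<phi> ^ Suc (Suc m)) $ Suc m"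
    using T0 by (intro fps_Lagrange_inversion)
  also have "\<dots> = (\<Sum>i=0..m. of_nat ((2 * m + 4) choose Suc i) * 2 ^ Suc i * of_nat (m choose i))"
  proof -
    have "2 * Suc (Suc m) = 2 * m + 4" by simp
    then show ?thesis
      unfolding \<phi>_def power_mult[symmetric] fps_cayley_power_nth by (simp only:)
  qed
  \<comment> \<open>The summands agree one by one: after multiplication by i + 1, absorption
    rewrites (i+1) C(2m+4, i+1) as (2m+4) C(2m+3, i) and (m+1) C(m, i) as (i+1) C(m+1, i+1).\<close>
  also have "\<dots> = (\<Sum>i=0..m. of_nat (Suc (Suc m)) * (4 / of_nat (Suc m) * 
        (2 ^ i * of_nat ((2 * m + 3) choose i) * of_nat (Suc m choose Suc i))))"
  proof (rule sum.cong[OF refl])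
    fix i
    have 1: "of_nat (Suc i) * of_nat ((2 * m + 4) choose Suc i) = (2 * of_nat (Suc (Suc m)) * of_nat ((2 * m + 3) choose i) :: 'a)"
    proof -
      have "Suc i * ((2 * m + 4) choose Suc i) = 2 * Suc (Suc m) * ((2 * m + 3) choose i)"
        using Suc_times_binomial[of i "2 * m + 3"] by (simp add: eval_nat_numeral)
      from arg_cong[OF this, of "of_nat :: nat \<Rightarrow> 'a"] show ?thesis
        by (simp only: of_nat_mult of_nat_numeral)
    qed
    have 2: "of_nat (Suc i) * of_nat (Suc m choose Suc i) = (of_nat (Suc m) * of_nat (m choose i) :: 'a)"
      using arg_cong[OF Suc_times_binomial[of i m], of "of_nat :: nat \<Rightarrow> 'a"]
      by (simp only: of_nat_mult)
    have "of_nat (Suc i) * (of_nat (Suc m) * (of_nat ((2 * m + 4) choose Suc i) * 2 ^ Suc i * of_nat (m choose i))) =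
      (2 ^ Suc i * of_nat (Suc m) * of_nat (m choose i)) * (of_nat (Suc i) * of_nat ((2 * m + 4) choose Suc i) :: 'a)"
      by (simp only: mult_ac)
    also have "\<dots> = (2 ^ Suc i * (of_nat (Suc i) * of_nat (Suc m choose Suc i))) * (2 * of_nat (Suc (Suc m)) * of_nat ((2 * m + 3) choose i))"
      unfolding 1 2 by (simp only: mult_ac)
    also have "\<dots> = of_nat (Suc i) * (of_nat (Suc (Suc m)) * (4 * (2 ^ i * of_nat ((2 * m + 3) choose i) * of_nat (Suc m choose Suc i))))"
      by (simp only: power_Suc mult_ac) simp
    finally have "of_nat (Suc m) * (of_nat ((2 * m + 4) choose Suc i) * 2 ^ Suc i * of_nat (m choose i)) =
       (of_nat (Suc (Suc m)) * (4 * (2 ^ i * of_nat ((2 * m + 3) choose i) * of_nat (Suc m choose Suc i))) :: 'a)"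
      by (simp only: mult_cancel_left of_nat_eq_0_iff) simp
    then show "of_nat ((2 * m + 4) choose Suc i) * 2 ^ Suc i * of_nat (m choose i) =
      (of_nat (Suc (Suc m)) * (4 / of_nat (Suc m) *
         (2 ^ i * of_nat ((2 * m + 3) choose i) * of_nat (Suc m choose Suc i))) :: 'a)"
      by (simp add: divide_simps mult_ac del: of_nat_Suc binomial_Suc_Suc power_Suc)
  qed
  finally show ?thesis
    unfolding sum_distrib_left[symmetric] mult_cancel_left by (simp del: of_nat_Suc)
qed

end

subsection \<open>Decomposition of separable permutations\<close>

text \<open>Values are integers so that negating \<open>f\<close> turns skew cuts into ascent cuts
  and 2413 into 3142. The length is a separate argument so that a prefix is the same
  \<open>f\<close> with a smaller \<open>m\<close>.\<close>

definition ascent_cut :: "(nat \<Rightarrow> int) \<Rightarrow> nat \<Rightarrow> nat \<Rightarrow> bool" where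
  "ascent_cut f m k \<longleftrightarrow> 0 < k \<and> k < m \<and> (\<forall>i j. i < k \<and> k \<le> j \<and> j < m \<longrightarrow> f i < f j)"

definition contains_3142 :: "(nat \<Rightarrow> int) \<Rightarrow> nat \<Rightarrow> bool" where
  "contains_3142 f m \<longleftrightarrow>
     (\<exists>i j k l. i < j \<and> j < k \<and> k < l \<and> l < m \<and> f j < f l \<and> f l < f i \<and> f i < f k)"

lemma contains_3142_mono: "contains_3142 f m \<Longrightarrow> m \<le> n \<Longrightarrow> contains_3142 f n"
  unfolding contains_3142_def by (meson order_less_le_trans)

lemma ascent_cut_trans: "ascent_cut f m k \<Longrightarrow> ascent_cut f k l \<Longrightarrow> ascent_cut f m l"
  unfolding ascent_cut_def
proof (intro conjI allI impI; elim conjE)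
  fix i j
  assume "k < m" "l < k" "i < l" "l \<le> j" "j < m"
    and "\<forall>i j. i < k \<and> k \<le> j \<and> j < m \<longrightarrow> f i < f j" "\<forall>i j. i < l \<and> l \<le> j \<and> j < k \<longrightarrow> f i < f j"
  then show "f i < f j" by (cases "j < k") auto
qed auto

text \<open>
  If the new last value falls strictly between values of the first sum component, then that component
  is a skew sum \<open>C \<ominus> D\<close>, and some \<open>c \<in> C\<close>, some \<open>d \<in> D\<close>, the entry after the component and the new
  value form a 3142.
\<close>

lemma cut_extend:
  fixes f :: "nat \<Rightarrow> int"
  assumes inj: "inj_on f {..<Suc m}" and avoid: "\<not> contains_3142 f (Suc m)"
    and cut: "ascent_cut f m k0"
    and IH: "\<And>m'. 2 \<le> m' \<Longrightarrow> m' < m \<Longrightarrow> (\<exists>k. ascent_cut f m' k) \<or> (\<exists>k. ascent_cut (\<lambda>i. - f i) m' k)"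
  shows "(\<exists>k. ascent_cut f (Suc m) k) \<or> (\<exists>k. ascent_cut (\<lambda>i. - f i) (Suc m) k)"
proof -
  define k where "k = (LEAST k. ascent_cut f m k)"
  have k: "ascent_cut f m k" unfolding k_def using cut by (rule LeastI)
  have least: "\<not> ascent_cut f m k'" if "k' < k" for k'
    using that unfolding k_def by (rule not_less_Least)
  have k0: "0 < k" "k < m" and klt: "\<And>i j. i < k \<Longrightarrow> k \<le> j \<Longrightarrow> j < m \<Longrightarrow> f i < f j"
    using k by (auto simp: ascent_cut_def)
  have ne: "f i \<noteq> f m" if "i < m" for i
    using inj_onD[OF inj, of i m] that by auto
  \<comment> \<open>The new value is compared with the first component only. Above all of it, the
    old cut survives; below all of it, the new value is the overall minimum and its own skew
    component.\<close>
  consider "\<forall>i<k. f i < f m" | "\<forall>i<k. f m < f i" |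
    i0 i1 where "i0 < k" "f m < f i0" "i1 < k" "f i1 < f m"
    using ne k0 by (meson less_trans linorder_neqE)
  then show ?thesis
  proof cases
    case 1
    then have "ascent_cut f (Suc m) k"
      using k0 klt by (auto simp: ascent_cut_def less_Suc_eq)
    then show ?thesis by blast
  next
    case 2
    have "f m < f i" if "i < m" for i
      using 2 klt[of 0 i] k0 that by (metis leI less_trans)
    then have "ascent_cut (\<lambda>i. - f i) (Suc m) m"
      using k0 by (auto simp: ascent_cut_def less_Suc_eq)
    then show ?thesis by blast
  next
    case 3
    then have "2 \<le> k" by (cases "k = 1") auto
    \<comment> \<open>A cut of the first component would be a smaller cut of the whole, so the
      induction hypothesis can only yield a skew cut.\<close>
    moreover have "\<not> ascent_cut f k k'" for k'
      using ascent_cut_trans[OF k] least by (metis ascent_cut_def)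
    ultimately obtain k' where k': "ascent_cut (\<lambda>i. - f i) k k'"
      using IH k0 by blast
    then have k'0: "0 < k'" "k' < k" and gt: "\<And>i j. i < k' \<Longrightarrow> k' \<le> j \<Longrightarrow> j < k \<Longrightarrow> f j < f i"
      by (auto simp: ascent_cut_def)
    obtain c where c: "c < k'" "f m < f c"
      using 3 gt[of 0 i0] k'0 by (metis leI less_trans)
    obtain d where d: "k' \<le> d" "d < k" "f d < f m"
      using 3 gt[of i1 k'] k'0 by (metis leI less_trans order_refl)
    have "contains_3142 f (Suc m)"
      unfolding contains_3142_def
      using c d k0 klt[of c k] by (intro exI[of _ c] exI[of _ d] exI[of _ k] exI[of _ m]) auto
    with avoid show ?thesis by blast
  qed
qed

text \<open>Induction on the length: the prefix without the last entry has a cut of one kind, and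
  \<open>cut_extend\<close> adds that entry. A descent cut is handled by the same lemma for the
  negated sequence.\<close>

lemma ascent_or_descent_cut:
  fixes f :: "nat \<Rightarrow> int"
  assumes "inj_on f {..<m}" "\<not> contains_3142 f m" "\<not> contains_3142 (\<lambda>i. - f i) m" "2 \<le> m"
  shows "(\<exists>k. ascent_cut f m k) \<or> (\<exists>k. ascent_cut (\<lambda>i. - f i) m k)"
  using assms
proof (induction m rule: less_induct)
  case (less m)
  show ?case
  proof (cases "m = 2")
    case True
    have "f 0 \<noteq> f 1" using inj_onD[OF less.prems(1), of 0 1] True by auto
    then have "ascent_cut f m 1 \<or> ascent_cut (\<lambda>i. - f i) m 1"
      using True by (auto simp: ascent_cut_def less_2_cases_iff)
    then show ?thesis by blast
  next
    case False
    then obtain m0 where m: "m = Suc m0" "2 \<le> m0" using less.prems(4) by (cases m) auto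
    have IH: "(\<exists>k. ascent_cut f m' k) \<or> (\<exists>k. ascent_cut (\<lambda>i. - f i) m' k)" if "2 \<le> m'" "m' < m" for m'
      using less.IH[OF that(2)] less.prems that contains_3142_mono[of _ m' m]
      by (meson inj_on_subset lessThan_subset_iff less_imp_le)
    have inj': "inj_on (\<lambda>i. - f i) {..<m}" using less.prems(1) by (auto simp: inj_on_def)
    from IH[of m0] m consider k where "ascent_cut f m0 k" | k where "ascent_cut (\<lambda>i. - f i) m0 k"
      by auto
    then show ?thesis
    proof cases
      case 1
      show ?thesis
        using cut_extend[of f m0 k] 1 less.prems(1,2) IH unfolding m(1) by (meson less_SucI)
    next
      case 2
      have "(\<exists>k. ascent_cut (\<lambda>i. - f i) m k) \<or> (\<exists>k. ascent_cut (\<lambda>i. - (- f i)) m k)"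
        unfolding m(1)
      proof (rule cut_extend)
        fix m' assume "2 \<le> m'" "m' < m0"
        then show "(\<exists>k. ascent_cut (\<lambda>i. - f i) m' k) \<or> (\<exists>k. ascent_cut (\<lambda>i. - (- f i)) m' k)"
          using IH[of m'] m by auto
      qed (use 2 less.prems inj' m in auto)
      then show ?thesis by auto
    qed
  qed
qed

section \<open>Separable zigzag permutations as lists\<close>

text \<open>The first disjunct is an occurrence of 2413, the second of 3142; taken together they are
  invariant under complementation.\<close>

definition forbidden :: "nat list \<Rightarrow> nat \<Rightarrow> nat \<Rightarrow> nat \<Rightarrow> nat \<Rightarrow> bool" where
  "forbidden l i j k n \<longleftrightarrow> i < j \<and> j < k \<and> k < n \<and> n < length l \<and>
     (l ! k < l ! i \<and> l ! i < l ! n \<and> l ! n < l ! j \<or> l ! j < l ! n \<and> l ! n < l ! i \<and> l ! i < l ! k)"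

definition separable :: "nat list \<Rightarrow> bool" where
  "separable l \<longleftrightarrow> (\<forall>i j k n. \<not> forbidden l i j k n)"

text \<open>Positions are counted from 0, so \<open>zigzag True\<close> is up-down and \<open>zigzag False\<close> is down-up.\<close>

definition zigzag :: "bool \<Rightarrow> nat list \<Rightarrow> bool" where
  "zigzag b l \<longleftrightarrow> (\<forall>i. Suc i < length l \<longrightarrow>
     (if even i = b then l ! i < l ! Suc i else l ! Suc i < l ! i))"

definition sum_cut :: "nat list \<Rightarrow> nat \<Rightarrow> bool" where
  "sum_cut l k \<longleftrightarrow> 0 < k \<and> k < length l \<and> (\<forall>i j. i < k \<and> k \<le> j \<and> j < length l \<longrightarrow> l ! i < l ! j)"

definition skew_cut :: "nat list \<Rightarrow> nat \<Rightarrow> bool" where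
  "skew_cut l k \<longleftrightarrow> 0 < k \<and> k < length l \<and> (\<forall>i j. i < k \<and> k \<le> j \<and> j < length l \<longrightarrow> l ! j < l ! i)"

definition perm_list :: "nat \<Rightarrow> nat list \<Rightarrow> bool" where
  "perm_list m l \<longleftrightarrow> length l = m \<and> set l = {1..m}"

definition sep_zigzag :: "bool \<Rightarrow> nat \<Rightarrow> nat list set" where
  "sep_zigzag b m = {l. perm_list m l \<and> separable l \<and> zigzag b l}"

definition sum_dec :: "bool \<Rightarrow> nat \<Rightarrow> nat list set" where
  "sum_dec b m = {l \<in> sep_zigzag b m. \<exists>k. sum_cut l k}"

definition skew_dec :: "bool \<Rightarrow> nat \<Rightarrow> nat list set" where
  "skew_dec b m = {l \<in> sep_zigzag b m. \<exists>k. skew_cut l k}"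

lemma perm_list_distinct: "perm_list m l \<Longrightarrow> distinct l"
  unfolding perm_list_def by (auto intro: card_distinct)

lemma finite_sep_zigzag [simp]: "finite (sep_zigzag b m)"
proof (rule finite_subset)
  show "sep_zigzag b m \<subseteq> {l. set l \<subseteq> {1..m} \<and> length l = m}"
    by (auto simp: sep_zigzag_def perm_list_def)
qed (rule finite_lists_length_eq, simp)

lemma sum_cut_or_skew_cut:
  assumes "distinct l" "separable l" "2 \<le> length l"
  shows "(\<exists>k. sum_cut l k) \<or> (\<exists>k. skew_cut l k)"
proof -
  define f where "f i = int (l ! i)" for i
  have "inj_on f {..<length l}"
    using assms(1) by (auto simp: inj_on_def f_def nth_eq_iff_index_eq)
  moreover have "\<not> contains_3142 f (length l)" "\<not> contains_3142 (\<lambda>i. - f i) (length l)"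
    using assms(2)
    unfolding contains_3142_def separable_def forbidden_def f_def neg_less_iff_less of_nat_less_iff
    by blast+
  ultimately have "(\<exists>k. ascent_cut f (length l) k) \<or> (\<exists>k. ascent_cut (\<lambda>i. - f i) (length l) k)"
    using assms(3) by (intro ascent_or_descent_cut)
  then show ?thesis by (simp add: ascent_cut_def sum_cut_def skew_cut_def f_def)
qed

text \<open>The first and last entries lie on different sides of any cut, and the two kinds of cut
  order them oppositely.\<close>

lemma not_sum_cut_and_skew_cut:
  assumes "sum_cut l j" "skew_cut l k"
  shows False
proof -
  have "0 < j \<and> j \<le> length l - 1 \<and> length l - 1 < length l"
    "0 < k \<and> k \<le> length l - 1 \<and> length l - 1 < length l"
    using assms by (auto simp: sum_cut_def skew_cut_def)
  then have "l ! 0 < l ! (length l - 1)" "l ! (length l - 1) < l ! 0"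
    using assms unfolding sum_cut_def skew_cut_def by blast+
  then show False by simp
qed

lemma sum_cut_take: "sum_cut l k \<Longrightarrow> k < n \<Longrightarrow> n \<le> length l \<Longrightarrow> sum_cut (take n l) k"
  by (auto simp: sum_cut_def)

lemma sum_cut_trans: "sum_cut l n \<Longrightarrow> sum_cut (take n l) k \<Longrightarrow> sum_cut l k"
  unfolding sum_cut_def
proof (intro conjI allI impI; elim conjE)
  fix i j
  assume "n < length l" "k < length (take n l)" "i < k" "k \<le> j" "j < length l"
    and "\<forall>i j. i < n \<and> n \<le> j \<and> j < length l \<longrightarrow> l ! i < l ! j"
      "\<forall>i j. i < k \<and> k \<le> j \<and> j < length (take n l) \<longrightarrow> take n l ! i < take n l ! j"
  then show "l ! i < l ! j" by (cases "j < n") auto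
qed auto

text \<open>Neither 2413 nor 3142 is a direct sum, so no occurrence can straddle the cut.\<close>

lemma separable_sum_cut:
  assumes "sum_cut l c"
  shows "separable l \<longleftrightarrow> separable (take c l) \<and> separable (drop c l)"
proof (intro iffI conjI)
  assume l: "separable l"
  have "c < length l" using assms by (simp add: sum_cut_def)
  then have "forbidden (take c l) i j k n \<Longrightarrow> forbidden l i j k n"
    "forbidden (drop c l) i j k n \<Longrightarrow> forbidden l (c + i) (c + j) (c + k) (c + n)" for i j k n
    by (auto simp: forbidden_def)
  then show "separable (take c l)" "separable (drop c l)"
    using l unfolding separable_def by blast+
next
  assume "separable (take c l) \<and> separable (drop c l)"
  then have t: "\<not> forbidden (take c l) i j k n" and d: "\<not> forbidden (drop c l) i j k n" for i j k n
    by (auto simp: separable_def)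
  have c: "c < length l" and lt: "\<And>i j. i < c \<Longrightarrow> c \<le> j \<Longrightarrow> j < length l \<Longrightarrow> l ! i < l ! j"
    using assms by (auto simp: sum_cut_def)
  show "separable l"
    unfolding separable_def
  proof (intro allI notI)
    fix i j k n
    assume f: "forbidden l i j k n"
    then have ord: "i < j" "j < k" "k < n" "n < length l"
      and pat: "l ! k < l ! i \<and> l ! i < l ! n \<and> l ! n < l ! j \<or> l ! j < l ! n \<and> l ! n < l ! i \<and> l ! i < l ! k"
      by (auto simp: forbidden_def)
    consider "n < c" | "c \<le> i" | "i < c" "c \<le> n" by linarith
    then show False
    proof cases
      case 1
      then have "forbidden (take c l) i j k n" using ord pat c by (simp add: forbidden_def)
      then show False using t by blast
    next
      case 2
      then have "forbidden (drop c l) (i - c) (j - c) (k - c) (n - c)"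
        using ord pat c by (simp add: forbidden_def diff_less_mono)
      then show False using d by blast
    next
      case 3
      \<comment> \<open>First below last leaves only 2413. Its 1 lies below its 2, hence before the
        cut; then so does its 4, which would have to be smaller than its 3.\<close>
      then have "l ! i < l ! n" using lt ord by auto
      with pat have p: "l ! k < l ! i" "l ! n < l ! j" by auto
      have "k < c" using lt[of i k] 3 p ord by (meson leI less_asym less_trans)
      then have "l ! j < l ! n" using lt[of j n] ord 3 by auto
      with p show False by simp
    qed
  qed
qed

text \<open>The step across the cut, from position \<open>c - 1\<close> to \<open>c\<close>, is an
  ascent, which fixes the parity of \<open>c\<close>; the remainder then has to begin with a
  descent.\<close>

lemma zigzag_sum_cut:
  assumes "sum_cut l c"
  shows "zigzag b l \<longleftrightarrow> zigzag b (take c l) \<and> odd c = b \<and> zigzag False (drop c l)"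
proof -
  have c: "0 < c" "c < length l" and lt: "\<And>i j. i < c \<Longrightarrow> c \<le> j \<Longrightarrow> j < length l \<Longrightarrow> l ! i < l ! j"
    using assms by (auto simp: sum_cut_def)
  then have asc: "l ! (c - 1) < l ! c" by auto
  define ok where "ok i \<longleftrightarrow> (if even i = b then l ! i < l ! Suc i else l ! Suc i < l ! i)" for i
  have "zigzag b l \<longleftrightarrow> (\<forall>i. Suc i < length l \<longrightarrow> ok i)" by (simp add: zigzag_def ok_def)
  also have "\<dots> \<longleftrightarrow> (\<forall>i. Suc i < c \<longrightarrow> ok i) \<and> ok (c - 1) \<and> (\<forall>i. Suc i < length l - c \<longrightarrow> ok (c + i))"
  proof (intro iffI conjI allI impI)
    fix i
    assume a: "(\<forall>i. Suc i < c \<longrightarrow> ok i) \<and> ok (c - 1) \<and> (\<forall>i. Suc i < length l - c \<longrightarrow> ok (c + i))"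
      and i: "Suc i < length l"
    consider "Suc i < c" | "i = c - 1" | "c \<le> i" using c by linarith
    then show "ok i"
    proof cases
      case 3
      then have "ok (c + (i - c))" using a i c by (metis Suc_diff_le diff_less_mono le_SucI)
      with 3 show ?thesis by simp
    qed (use a in auto)
  qed (use c in auto)
  also have "(\<forall>i. Suc i < c \<longrightarrow> ok i) \<longleftrightarrow> zigzag b (take c l)"
    using c by (auto simp: zigzag_def ok_def)
  also have "ok (c - 1) \<longleftrightarrow> odd c = b" using asc c by (auto simp: ok_def)
  finally show ?thesis
    using c by (auto simp: zigzag_def ok_def)
qed

lemma separable_map:
  assumes "strict_mono g"
  shows "separable (map g l) \<longleftrightarrow> separable l"
proof -
  have "forbidden (map g l) i j k n \<longleftrightarrow> forbidden l i j k n" for i j k n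
    by (auto simp: forbidden_def strict_mono_less[OF assms])
  then show ?thesis by (simp add: separable_def)
qed

lemma zigzag_map: "strict_mono g \<Longrightarrow> zigzag b (map g l) \<longleftrightarrow> zigzag b l"
  unfolding zigzag_def by (auto simp: strict_mono_less)

section \<open>Direct sums and the counting recursion\<close>

definition direct_sum :: "nat list \<Rightarrow> nat list \<Rightarrow> nat list" where
  "direct_sum a c = a @ map ((+) (length a)) c"

lemma perm_list_direct_sum:
  assumes "perm_list k a" "perm_list n c"
  shows "perm_list (k + n) (direct_sum a c)"
proof -
  have "{1..k} \<union> (+) k ` {1..n} = {1..k + n}" by (auto simp: image_iff; presburger)
  then show ?thesis using assms by (auto simp: perm_list_def direct_sum_def)
qed

lemma sum_cut_direct_sum:
  assumes "perm_list k a" "perm_list n c" "0 < k" "0 < n"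
  shows "sum_cut (direct_sum a c) k"
  unfolding sum_cut_def
proof (intro conjI allI impI)
  fix i j
  assume "i < k \<and> k \<le> j \<and> j < length (direct_sum a c)"
  then have i: "i < length a" and j: "length a \<le> j" "j - length a < length c"
    using assms by (auto simp: direct_sum_def perm_list_def)
  have "a ! i \<in> {1..k}" "c ! (j - length a) \<in> {1..n}"
    using nth_mem[OF i] nth_mem[OF j(2)] assms by (auto simp: perm_list_def)
  then show "direct_sum a c ! i < direct_sum a c ! j"
    using i j assms by (auto simp: direct_sum_def nth_append perm_list_def)
qed (use assms in \<open>auto simp: direct_sum_def perm_list_def\<close>)

lemma sep_zigzag_direct_sum:
  assumes "perm_list k a" "perm_list n c" "0 < k" "0 < n"
  shows "direct_sum a c \<in> sep_zigzag b (k + n) \<longleftrightarrow>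
    a \<in> sep_zigzag b k \<and> odd k = b \<and> c \<in> sep_zigzag False n"
proof -
  have "take k (direct_sum a c) = a" "drop k (direct_sum a c) = map ((+) k) c"
    using assms by (auto simp: direct_sum_def perm_list_def)
  moreover have "strict_mono ((+) k)" by (auto simp: strict_mono_def)
  ultimately show ?thesis
    using assms separable_sum_cut[OF sum_cut_direct_sum[OF assms]]
      zigzag_sum_cut[OF sum_cut_direct_sum[OF assms], of b]
    by (auto simp: sep_zigzag_def perm_list_direct_sum separable_map zigzag_map)
qed

text \<open>The entries before the cut form a downward closed subset of {1..m} with k elements,
  hence are {1..k}; the others become a permutation after subtracting k.\<close>

lemma perm_list_sum_cut:
  assumes l: "perm_list m l" and cut: "sum_cut l k"
  obtains c where "perm_list k (take k l)" "perm_list (m - k) c" "l = direct_sum (take k l) c"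
proof -
  let ?A = "set (take k l)" and ?B = "set (drop k l)"
  have k: "0 < k" "k < m" using cut l by (auto simp: sum_cut_def perm_list_def)
  have len: "length l = m" using l by (simp add: perm_list_def)
  have AB: "?A \<union> ?B = {1..m}" using l by (metis append_take_drop_id perm_list_def set_append)
  have d: "distinct l" using l by (rule perm_list_distinct)
  have lt: "a < b" if a: "a \<in> ?A" and b: "b \<in> ?B" for a b
  proof -
    obtain i where "i < length (take k l)" "a = take k l ! i"
      using a by (metis in_set_conv_nth)
    then have i: "i < k" "a = l ! i" by auto
    obtain j where "j < length (drop k l)" "b = drop k l ! j"
      using b by (metis in_set_conv_nth)
    then have j: "k \<le> k + j" "k + j < length l" "b = l ! (k + j)" by auto
    show ?thesis using cut i j unfolding sum_cut_def by blast
  qed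
  have cA: "card ?A = k" using d k len by (simp add: distinct_card)
  define M where "M = Max ?A"
  have ne: "?A \<noteq> {}" using cA k by auto
  \<comment> \<open>A value up to the maximum \<open>M\<close> cannot lie in \<open>?B\<close>, as
    everything there exceeds \<open>M\<close>.\<close>
  have "?A = {1..M}"
  proof
    show "?A \<subseteq> {1..M}" using AB by (auto simp: M_def)
    show "{1..M} \<subseteq> ?A"
    proof
      fix v assume v: "v \<in> {1..M}"
      have M: "M \<in> ?A" unfolding M_def using ne by (intro Max_in) auto
      then have "M \<in> {1..m}" using AB by blast
      then have "v \<in> ?A \<union> ?B" unfolding AB using v by auto
      moreover have "v \<notin> ?B" using lt[OF M] v by fastforce
      ultimately show "v \<in> ?A" by blast
    qed
  qed
  with cA have A: "?A = {1..k}" by simp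
  have "?A \<inter> ?B = {}" using lt by blast
  then have "?B = {1..m} - {1..k}" using AB A by blast
  also have "\<dots> = {k + 1..m}" by auto
  finally have B: "?B = {k + 1..m}" .
  define c where "c = map (\<lambda>v. v - k) (drop k l)"
  have mc: "map ((+) k) c = drop k l"
    unfolding c_def map_map by (rule map_idI) (use B in auto)
  have "perm_list k (take k l)" using A len k by (simp add: perm_list_def)
  moreover have "perm_list (m - k) c"
  proof -
    have "set c = (\<lambda>v. v - k) ` {k + 1..m}" using B by (simp add: c_def)
    also have "\<dots> = {1..m - k}"
    proof -
      have "x \<in> (\<lambda>v. v - k) ` {k + 1..m}" if "x \<in> {1..m - k}" for x
        using that by (intro image_eqI[of _ _ "x + k"]) auto
      then show ?thesis by auto
    qed
    finally show ?thesis using len by (simp add: perm_list_def c_def)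
  qed
  moreover have "l = direct_sum (take k l) c"
    using mc len k by (simp add: direct_sum_def min_def)
  ultimately show ?thesis by (rule that)
qed

text \<open>Cutting at the least sum cut is a bijection onto pairs of an indecomposable first
  summand and an arbitrary remainder; \<open>k\<close> is the length of the former.\<close>

lemma card_sum_dec:
  "card (sum_dec b m) = (\<Sum>k | k \<in> {1..<m} \<and> odd k = b.
     (card (sep_zigzag b k) - card (sum_dec b k)) * card (sep_zigzag False (m - k)))"
proof -
  let ?K = "{k. k \<in> {1..<m} \<and> odd k = b}"
  let ?S = "\<lambda>k. (sep_zigzag b k - sum_dec b k) \<times> sep_zigzag False (m - k)"
  have cut: "sum_cut (direct_sum a c) k" and len: "length a = k"
    and indec: "\<not> sum_cut a j" and take: "take k (direct_sum a c) = a"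
    if "(a, c) \<in> ?S k" "k \<in> ?K" for a c k j
    using that sum_cut_direct_sum[of k a "m - k" c]
    by (auto simp: sep_zigzag_def sum_dec_def perm_list_def direct_sum_def)
  have inj: "inj_on (\<lambda>(a, c). direct_sum a c) (\<Union>k\<in>?K. ?S k)"
  proof (rule inj_onI, clarify)
    fix a c k a' c' k'
    assume S: "k \<in> {1..<m}" "b = odd k" "k' \<in> {1..<m}" "odd k' = odd k"
      "a \<in> sep_zigzag (odd k) k" "a \<notin> sum_dec (odd k) k" "c \<in> sep_zigzag False (m - k)"
      "a' \<in> sep_zigzag (odd k) k'" "a' \<notin> sum_dec (odd k) k'" "c' \<in> sep_zigzag False (m - k')"
      and eq: "direct_sum a c = direct_sum a' c'"
    have "(a, c) \<in> ?S k" "k \<in> ?K" "(a', c') \<in> ?S k'" "k' \<in> ?K" using S by auto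
    note ac = cut[OF this(1,2)] len[OF this(1,2)] indec[OF this(1,2)] take[OF this(1,2)]
      and ac' = cut[OF this(3,4)] len[OF this(3,4)] indec[OF this(3,4)] take[OF this(3,4)]
    \<comment> \<open>Otherwise the cut at \<open>k\<close> of the common sum would cut the longer
      first summand \<open>a'\<close>, which is indecomposable.\<close>
    have "\<not> k < k'"
      using sum_cut_take[of "direct_sum a c" k k'] ac(1) ac'(1,3,4) eq
      by (metis less_imp_le sum_cut_def)
    moreover have "\<not> k' < k"
      using sum_cut_take[of "direct_sum a' c'" k' k] ac'(1) ac(1,3,4) eq
      by (metis less_imp_le sum_cut_def)
    ultimately have "length a = length a'" using ac ac' by simp
    then show "a = a' \<and> c = c'" using eq by (auto simp: direct_sum_def)
  qed
  have img: "(\<lambda>(a, c). direct_sum a c) ` (\<Union>k\<in>?K. ?S k) = sum_dec b m"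
  proof (rule set_eqI, rule iffI)
    fix l
    assume "l \<in> (\<lambda>(a, c). direct_sum a c) ` (\<Union>k\<in>?K. ?S k)"
    then obtain k a c where k: "k \<in> ?K" and ac: "(a, c) \<in> ?S k" and l: "l = direct_sum a c" by auto
    have "direct_sum a c \<in> sep_zigzag b (k + (m - k))"
      using k ac by (subst sep_zigzag_direct_sum) (auto simp: sep_zigzag_def)
    then show "l \<in> sum_dec b m" using cut[OF ac k] k by (auto simp: sum_dec_def l)
  next
    fix l
    assume l: "l \<in> sum_dec b m"
    then have perm: "perm_list m l" and sep: "l \<in> sep_zigzag b m" and ex: "\<exists>k. sum_cut l k"
      by (auto simp: sum_dec_def sep_zigzag_def)
    define k where "k = (LEAST k. sum_cut l k)"
    have k: "sum_cut l k" unfolding k_def using ex by (rule LeastI_ex)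
    have least: "\<not> sum_cut l j" if "j < k" for j
      using that unfolding k_def by (rule not_less_Least)
    have k0: "0 < k" "k < m" using k perm by (auto simp: sum_cut_def perm_list_def)
    obtain c where c: "perm_list k (take k l)" "perm_list (m - k) c" "l = direct_sum (take k l) c"
      using perm_list_sum_cut[OF perm k] .
    \<comment> \<open>A cut of the prefix would be a cut of \<open>l\<close> below the least
      one.\<close>
    have "\<not> sum_cut (take k l) j" for j
      using sum_cut_trans[OF k] least by (metis length_take min_less_iff_conj sum_cut_def)
    moreover have "take k l \<in> sep_zigzag b k \<and> odd k = b \<and> c \<in> sep_zigzag False (m - k)"
      using sep sep_zigzag_direct_sum[OF c(1,2), of b] c(3) k0 by simp
    ultimately have "(take k l, c) \<in> ?S k" "k \<in> ?K" using k0 by (auto simp: sum_dec_def)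
    then show "l \<in> (\<lambda>(a, c). direct_sum a c) ` (\<Union>k\<in>?K. ?S k)"
      using c(3) by (intro image_eqI[of _ _ "(take k l, c)"]) auto
  qed
  have "card (sum_dec b m) = card (\<Union>k\<in>?K. ?S k)"
    using card_image[OF inj] unfolding img .
  also have "\<dots> = (\<Sum>k\<in>?K. card (?S k))"
  proof (rule card_UN_disjoint)
    show "\<forall>i\<in>?K. \<forall>j\<in>?K. i \<noteq> j \<longrightarrow> ?S i \<inter> ?S j = {}"
      by (auto simp: sep_zigzag_def perm_list_def)
  qed auto
  also have "\<dots> = (\<Sum>k\<in>?K. (card (sep_zigzag b k) - card (sum_dec b k)) * card (sep_zigzag False (m - k)))"
  proof (rule sum.cong[OF refl])
    fix k
    have "sum_dec b k \<subseteq> sep_zigzag b k" "finite (sum_dec b k)" by (auto simp: sum_dec_def)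
    then show "card (?S k) = (card (sep_zigzag b k) - card (sum_dec b k)) * card (sep_zigzag False (m - k))"
      by (simp add: card_cartesian_product card_Diff_subset)
  qed
  finally show ?thesis .
qed

section \<open>Complementation\<close>

definition complement :: "nat \<Rightarrow> nat list \<Rightarrow> nat list" where
  "complement m l = map (\<lambda>v. Suc m - v) l"

lemma complement_complement: "perm_list m l \<Longrightarrow> complement m (complement m l) = l"
  unfolding complement_def map_map by (rule map_idI) (auto simp: perm_list_def)

lemma perm_list_complement:
  assumes "perm_list m l"
  shows "perm_list m (complement m l)"
proof -
  have "x \<in> (\<lambda>v. Suc m - v) ` {1..m}" if "x \<in> {1..m}" for x
    using that by (intro image_eqI[of _ _ "Suc m - x"]) auto
  then have "(\<lambda>v. Suc m - v) ` {1..m} = {1..m}" by auto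
  then show ?thesis using assms by (simp add: perm_list_def complement_def)
qed

lemma complement_nth_less_iff:
  assumes "perm_list m l" "i < length l" "j < length l"
  shows "complement m l ! i < complement m l ! j \<longleftrightarrow> l ! j < l ! i"
proof -
  have "l ! i \<in> {1..m}" "l ! j \<in> {1..m}" using assms by (auto simp: perm_list_def dest: nth_mem)
  then show ?thesis using assms by (auto simp: complement_def)
qed

lemma length_complement [simp]: "length (complement m l) = length l"
  by (simp add: complement_def)

text \<open>Complementation reverses every comparison, so it swaps 2413 with 3142 and ascents with
  descents.\<close>

lemma complement_in_sep_zigzag:
  assumes "l \<in> sep_zigzag b m"
  shows "complement m l \<in> sep_zigzag (\<not> b) m"
proof -
  have l: "perm_list m l" "separable l" "zigzag b l" using assms by (auto simp: sep_zigzag_def)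
  note less = complement_nth_less_iff[OF l(1)]
  have "forbidden (complement m l) i j k n \<Longrightarrow> forbidden l i j k n" for i j k n
    by (auto simp: forbidden_def less)
  then have "separable (complement m l)" using l(2) unfolding separable_def by blast
  moreover have "zigzag (\<not> b) (complement m l)"
    using l(3) by (auto simp: zigzag_def less)
  ultimately show ?thesis using perm_list_complement[OF l(1)] by (simp add: sep_zigzag_def)
qed

lemma cut_complement:
  assumes "perm_list m l"
  shows "sum_cut (complement m l) k \<longleftrightarrow> skew_cut l k"
  unfolding sum_cut_def skew_cut_def by (auto simp: complement_nth_less_iff[OF assms])

lemma card_sep_zigzag_complement: "card (sep_zigzag (\<not> b) m) = card (sep_zigzag b m)"
proof -
  have "bij_betw (complement m) (sep_zigzag b m) (sep_zigzag (\<not> b) m)"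
  proof (rule bij_betw_byWitness[where f' = "complement m"])
    show "complement m ` sep_zigzag b m \<subseteq> sep_zigzag (\<not> b) m"
      using complement_in_sep_zigzag by blast
    show "complement m ` sep_zigzag (\<not> b) m \<subseteq> sep_zigzag b m"
      using complement_in_sep_zigzag[of _ "\<not> b" m] by auto
  qed (auto simp: sep_zigzag_def complement_complement)
  then show ?thesis by (simp add: bij_betw_same_card)
qed

text \<open>Through complementation the recursion for direct sums also counts skew sums.\<close>

lemma card_skew_dec: "card (skew_dec b m) = card (sum_dec (\<not> b) m)"
proof -
  have perm: "perm_list m l" if "l \<in> sep_zigzag c m" for l c using that by (simp add: sep_zigzag_def)
  have "bij_betw (complement m) (skew_dec b m) (sum_dec (\<not> b) m)"
  proof (rule bij_betw_byWitness[where f' = "complement m"])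
    show "complement m ` skew_dec b m \<subseteq> sum_dec (\<not> b) m"
      by (auto simp: skew_dec_def sum_dec_def complement_in_sep_zigzag cut_complement[OF perm])
    show "complement m ` sum_dec (\<not> b) m \<subseteq> skew_dec b m"
    proof clarify
      fix l assume "l \<in> sum_dec (\<not> b) m"
      then have l: "l \<in> sep_zigzag (\<not> b) m" "\<exists>k. sum_cut l k" by (auto simp: sum_dec_def)
      have c: "complement m l \<in> sep_zigzag b m" using complement_in_sep_zigzag[OF l(1)] by simp
      have "\<exists>k. skew_cut (complement m l) k"
        using l(2) cut_complement[OF perm[OF c]] complement_complement[OF perm[OF l(1)]] by simp
      with c show "complement m l \<in> skew_dec b m" by (simp add: skew_dec_def)
    qed
  qed (auto simp: skew_dec_def sum_dec_def intro: complement_complement perm)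
  then show ?thesis by (rule bij_betw_same_card)
qed

text \<open>From length 2 on exactly one kind of cut exists; the permutation of length 1 has
  none.\<close>

lemma card_sep_zigzag_split:
  assumes "2 \<le> m"
  shows "card (sep_zigzag b m) = card (sum_dec b m) + card (sum_dec (\<not> b) m)"
proof -
  have "sep_zigzag b m = sum_dec b m \<union> skew_dec b m"
  proof (intro equalityI subsetI)
    fix l assume l: "l \<in> sep_zigzag b m"
    then have "perm_list m l" "separable l" by (auto simp: sep_zigzag_def)
    then have "(\<exists>k. sum_cut l k) \<or> (\<exists>k. skew_cut l k)"
      using sum_cut_or_skew_cut[OF perm_list_distinct] assms by (simp add: perm_list_def)
    with l show "l \<in> sum_dec b m \<union> skew_dec b m" by (auto simp: sum_dec_def skew_dec_def)
  qed (auto simp: sum_dec_def skew_dec_def)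
  moreover have "sum_dec b m \<inter> skew_dec b m = {}"
    using not_sum_cut_and_skew_cut by (auto simp: sum_dec_def skew_dec_def)
  moreover have "finite (sum_dec b m)" "finite (skew_dec b m)"
    by (auto simp: sum_dec_def skew_dec_def)
  ultimately show ?thesis by (simp add: card_Un_disjoint card_skew_dec)
qed

lemma sep_zigzag_1: "sep_zigzag b 1 = {[1]}"
  by (auto simp: sep_zigzag_def perm_list_def separable_def forbidden_def zigzag_def length_Suc_conv)

subsection \<open>Generating functions\<close>

lemma All_less_4: "(\<forall>a<4::nat. P a) \<longleftrightarrow> P 0 \<and> P 1 \<and> P 2 \<and> P 3"
  by (auto simp: eval_nat_numeral less_Suc_eq)

text \<open>The index function is replaced by four explicit positions, shifted to count from 0 as in
  lists.\<close>

lemma contains_pattern_4_iff: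
  assumes "length p = 4"
  shows "contains_pattern m \<pi> p \<longleftrightarrow> (\<exists>i j k n. i < j \<and> j < k \<and> k < n \<and> n < m \<and>
    (\<forall>a<4. \<forall>b<4. \<pi> (Suc ([i, j, k, n] ! a)) < \<pi> (Suc ([i, j, k, n] ! b)) \<longleftrightarrow> p ! a < p ! b))"
    (is "?l \<longleftrightarrow> ?r")
proof
  assume ?l
  then obtain x where len: "\<forall>a<4. 1 \<le> x a \<and> x a \<le> m" and inc: "\<And>a b. a < b \<Longrightarrow> b < 4 \<Longrightarrow> x a < x b"
    and pat: "\<forall>a<4. \<forall>b<4. \<pi> (x a) < \<pi> (x b) \<longleftrightarrow> p ! a < p ! b"
    unfolding contains_pattern_def assms by blast
  let ?y = "[x 0 - 1, x 1 - 1, x 2 - 1, x 3 - 1]"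
  have "x 0 < x 1" "x 1 < x 2" "x 2 < x 3" by (rule inc; simp)+
  moreover have pos: "1 \<le> x 0" "1 \<le> x 1" "1 \<le> x 2" "1 \<le> x 3" "x 3 \<le> m"
    using len unfolding All_less_4 by auto
  ultimately have "x 0 - 1 < x 1 - 1" "x 1 - 1 < x 2 - 1" "x 2 - 1 < x 3 - 1" "x 3 - 1 < m"
    by linarith+
  moreover have "\<forall>a<4. Suc (?y ! a) = x a"
    unfolding All_less_4 using pos by (simp add: numeral_eq_Suc)
  then have "\<forall>a<4. \<forall>b<4. \<pi> (Suc (?y ! a)) < \<pi> (Suc (?y ! b)) \<longleftrightarrow> p ! a < p ! b"
    using pat by simp
  ultimately show ?r by blast
next
  assume ?r
  then obtain i j k n where *: "i < j" "j < k" "k < n" "n < m"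
    and pat: "\<forall>a<4. \<forall>b<4. \<pi> (Suc ([i, j, k, n] ! a)) < \<pi> (Suc ([i, j, k, n] ! b)) \<longleftrightarrow> p ! a < p ! b"
    by blast
  let ?x = "\<lambda>a. Suc ([i, j, k, n] ! a)"
  have "\<forall>a<4. 1 \<le> ?x a \<and> ?x a \<le> m" "\<forall>a<4. \<forall>b<4. a < b \<longrightarrow> ?x a < ?x b"
    unfolding All_less_4 using * by (simp_all add: numeral_eq_Suc)
  then show ?l
    unfolding contains_pattern_def assms using pat by (intro exI[of _ ?x]) auto
qed

lemma contains_pattern_2413_iff:
  "contains_pattern m \<pi> [2,4,1,3] \<longleftrightarrow>
    (\<exists>i j k n. i < j \<and> j < k \<and> k < n \<and> n < m \<and>
      \<pi> (Suc k) < \<pi> (Suc i) \<and> \<pi> (Suc i) < \<pi> (Suc n) \<and> \<pi> (Suc n) < \<pi> (Suc j))"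
proof -
  have "(\<forall>a<4. \<forall>b<4. \<pi> (Suc ([i, j, k, n] ! a)) < \<pi> (Suc ([i, j, k, n] ! b)) \<longleftrightarrow> [2,4,1,3::nat] ! a < [2,4,1,3] ! b) \<longleftrightarrow>
     \<pi> (Suc k) < \<pi> (Suc i) \<and> \<pi> (Suc i) < \<pi> (Suc n) \<and> \<pi> (Suc n) < \<pi> (Suc j)" for i j k n
    unfolding All_less_4 by (simp add: numeral_eq_Suc) linarith
  then show ?thesis by (subst contains_pattern_4_iff) simp_all
qed

lemma contains_pattern_3142_iff:
  "contains_pattern m \<pi> [3,1,4,2] \<longleftrightarrow>
    (\<exists>i j k n. i < j \<and> j < k \<and> k < n \<and> n < m \<and>
      \<pi> (Suc j) < \<pi> (Suc n) \<and> \<pi> (Suc n) < \<pi> (Suc i) \<and> \<pi> (Suc i) < \<pi> (Suc k))"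
proof -
  have "(\<forall>a<4. \<forall>b<4. \<pi> (Suc ([i, j, k, n] ! a)) < \<pi> (Suc ([i, j, k, n] ! b)) \<longleftrightarrow> [3,1,4,2::nat] ! a < [3,1,4,2] ! b) \<longleftrightarrow>
     \<pi> (Suc j) < \<pi> (Suc n) \<and> \<pi> (Suc n) < \<pi> (Suc i) \<and> \<pi> (Suc i) < \<pi> (Suc k)" for i j k n
    unfolding All_less_4 by (simp add: numeral_eq_Suc) linarith
  then show ?thesis by (subst contains_pattern_4_iff) simp_all
qed

lemma separable_map_upt_iff:
  "separable (map \<pi> [1..<Suc m]) \<longleftrightarrow>
     \<not> contains_pattern m \<pi> [2,4,1,3] \<and> \<not> contains_pattern m \<pi> [3,1,4,2]"
proof -
  define P where "P i j k n \<longleftrightarrow> i < j \<and> j < k \<and> k < n \<and> n < m \<and>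
      \<pi> (Suc k) < \<pi> (Suc i) \<and> \<pi> (Suc i) < \<pi> (Suc n) \<and> \<pi> (Suc n) < \<pi> (Suc j)" for i j k n
  define Q where "Q i j k n \<longleftrightarrow> i < j \<and> j < k \<and> k < n \<and> n < m \<and>
      \<pi> (Suc j) < \<pi> (Suc n) \<and> \<pi> (Suc n) < \<pi> (Suc i) \<and> \<pi> (Suc i) < \<pi> (Suc k)" for i j k n
  have "forbidden (map \<pi> [1..<Suc m]) i j k n \<longleftrightarrow> P i j k n \<or> Q i j k n" for i j k n
    by (auto simp: forbidden_def P_def Q_def simp del: upt_Suc)
  then show ?thesis
    unfolding separable_def contains_pattern_2413_iff contains_pattern_3142_iff P_def[symmetric] Q_def[symmetric]
    by blast
qed

text \<open>The shift from 1-based to 0-based positions swaps parities: ascents after odd positions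
  become ascents after even ones.\<close>

lemma zigzag_map_upt_iff: "zigzag True (map \<pi> [1..<Suc m]) \<longleftrightarrow> alternating m \<pi>"
proof -
  have "zigzag True (map \<pi> [1..<Suc m]) \<longleftrightarrow>
      (\<forall>i. Suc i < m \<longrightarrow> (if even i then \<pi> (Suc i) < \<pi> (Suc (Suc i)) else \<pi> (Suc (Suc i)) < \<pi> (Suc i)))"
    by (auto simp: zigzag_def simp del: upt_Suc)
  also have "\<dots> \<longleftrightarrow> (\<forall>i. 1 \<le> Suc i \<and> Suc i < m \<longrightarrow>
      (odd (Suc i) \<longrightarrow> \<pi> (Suc i) < \<pi> (Suc (Suc i))) \<and> (even (Suc i) \<longrightarrow> \<pi> (Suc i) > \<pi> (Suc (Suc i))))"
    by auto
  also have "\<dots> \<longleftrightarrow> alternating m \<pi>"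
    unfolding alternating_def by (metis One_nat_def Suc_le_D)
  finally show ?thesis .
qed

text \<open>One-line notation is a bijection; it loses nothing because \<open>permutes\<close> fixes
  every point outside {1..m}.\<close>

lemma card_alt_avoid_set: "card (alt_avoid_set m) = card (sep_zigzag True m)"
proof -
  have "inj_on (\<lambda>\<pi>. map \<pi> [1..<Suc m]) (alt_avoid_set m)"
  proof (rule inj_onI)
    fix \<pi> \<sigma>
    assume "\<pi> \<in> alt_avoid_set m" "\<sigma> \<in> alt_avoid_set m" and eq: "map \<pi> [1..<Suc m] = map \<sigma> [1..<Suc m]"
    then have p: "\<pi> permutes {1..m}" "\<sigma> permutes {1..m}" by (auto simp: alt_avoid_set_def)
    have "\<pi> x = \<sigma> x" if "x \<in> {1..m}" for x
      using eq that by (auto simp: map_eq_conv simp del: upt_Suc)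
    then show "\<pi> = \<sigma>" using p by (metis ext permutes_not_in)
  qed
  moreover have "(\<lambda>\<pi>. map \<pi> [1..<Suc m]) ` alt_avoid_set m = sep_zigzag True m"
  proof (intro equalityI subsetI)
    fix l assume "l \<in> (\<lambda>\<pi>. map \<pi> [1..<Suc m]) ` alt_avoid_set m"
    then obtain \<pi> where \<pi>: "\<pi> \<in> alt_avoid_set m" and l: "l = map \<pi> [1..<Suc m]" by blast
    have "\<pi> ` {1..m} = {1..m}" using \<pi> by (auto simp: alt_avoid_set_def permutes_image)
    then have "perm_list m l"
      unfolding perm_list_def l by (simp add: atLeastLessThanSuc_atLeastAtMost del: upt_Suc)
    then show "l \<in> sep_zigzag True m"
      using \<pi> unfolding sep_zigzag_def alt_avoid_set_def l
      by (simp only: mem_Collect_eq separable_map_upt_iff zigzag_map_upt_iff) blast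
  next
    fix l assume l: "l \<in> sep_zigzag True m"
    then have perm: "perm_list m l" by (simp add: sep_zigzag_def)
    then have len: "length l = m" and set: "set l = {1..m}" by (auto simp: perm_list_def)
    \<comment> \<open>Outside {1..m} the function must be the identity for \<open>permutes\<close>
      to hold.\<close>
    define \<pi> where "\<pi> i = (if i \<in> {1..m} then l ! (i - 1) else i)" for i
    have map: "map \<pi> [1..<Suc m] = l"
      by (rule nth_equalityI) (auto simp: len \<pi>_def simp del: upt_Suc)
    have "\<pi> ` {1..m} = {1..m}"
      using arg_cong[OF map, of set] set by (simp add: atLeastLessThanSuc_atLeastAtMost del: upt_Suc)
    then have "bij_betw \<pi> {1..m} {1..m}"
      by (simp add: bij_betw_def eq_card_imp_inj_on)
    then have "\<pi> permutes {1..m}"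
      by (rule bij_imp_permutes) (auto simp: \<pi>_def)
    then have "\<pi> \<in> alt_avoid_set m"
      using l unfolding alt_avoid_set_def sep_zigzag_def
      by (simp only: mem_Collect_eq map flip: separable_map_upt_iff zigzag_map_upt_iff)
    then show "l \<in> (\<lambda>\<pi>. map \<pi> [1..<Suc m]) ` alt_avoid_set m"
      using map by (metis image_eqI)
  qed
  ultimately show ?thesis by (metis card_image)
qed

section \<open>Recursions as power series equations\<close>

lemma sum_odd_reindex:
  fixes m :: nat
  shows "(\<Sum>k | k \<in> {1..<m} \<and> odd k = True. f k) = (\<Sum>j | 2 * j + 1 < m. f (2 * j + 1))"
  by (rule sum.reindex_bij_witness[of _ "\<lambda>j. 2 * j + 1" "\<lambda>k. k div 2"]) auto

lemma sum_even_reindex: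
  fixes m :: nat
  shows "(\<Sum>k | k \<in> {1..<m} \<and> odd k = False. f k) = (\<Sum>j | 1 \<le> j \<and> 2 * j < m. f (2 * j))"
  by (rule sum.reindex_bij_witness[of _ "\<lambda>j. 2 * j" "\<lambda>k. k div 2"]) auto

text \<open>Over the rationals the truncated subtraction becomes an honest one, and complementation
  replaces every \<open>sep_zigzag\<close> count by the up-down count.\<close>

lemma of_nat_card_sum_dec:
  "(of_nat (card (sum_dec b m)) :: rat) = (\<Sum>k | k \<in> {1..<m} \<and> odd k = b.
     (of_nat (card (sep_zigzag True k)) - of_nat (card (sum_dec b k))) * of_nat (card (sep_zigzag True (m - k))))"
proof -
  have "card (sum_dec b k) \<le> card (sep_zigzag b k)" for k
    by (rule card_mono) (auto simp: sum_dec_def)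
  moreover have eq: "card (sep_zigzag c k) = card (sep_zigzag True k)" for c k
    using card_sep_zigzag_complement[of True k] by (cases c) auto
  ultimately show ?thesis
    by (subst card_sum_dec) (simp add: of_nat_diff eq[of b] eq[of False])
qed

context includes fps_syntax begin

lemma alternating_separable_fps:
  defines "S \<equiv> 1 + R_fps"
  shows "S * (1 - T_fps) = 1 + T_fps" and "T_fps = fps_X * S ^ 2"
proof -
  let ?x = "\<lambda>m. of_nat (card (sep_zigzag True m)) :: rat"
  let ?p = "\<lambda>b m. of_nat (card (sum_dec b m)) :: rat"
  \<comment> \<open>Sum-decomposable (\<open>P\<close>) and skew-decomposable (\<open>M\<close>) up-down permutations of odd and even length;
    the latter are counted, via complementation, by \<open>sum_dec False\<close>.\<close>
  define Po Pe Mo Me where "Po = Abs_fps (\<lambda>n. ?p True (2 * n + 1))" and "Pe = Abs_fps (\<lambda>n. ?p True (2 * n))"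
    and "Mo = Abs_fps (\<lambda>n. ?p False (2 * n + 1))" and "Me = Abs_fps (\<lambda>n. ?p False (2 * n))"
  note defs = Po_def Pe_def Mo_def Me_def
  have S: "S $ n = ?x (2 * n + 1)" for n
    using sep_zigzag_1[of True] by (cases n) (simp_all add: S_def R_fps_def r_seq_def card_alt_avoid_set)
  \<comment> \<open>The constant term is set to 0 although the empty list gives \<open>?x 0\<close>
    the value 1; both parts of a sum are nonempty.\<close>
  have T: "T_fps $ n = (if n = 0 then 0 else ?x (2 * n))" for n
    by (simp add: T_fps_def t_seq_def card_alt_avoid_set)
  have p0: "?p b 0 = 0" "?p b 1 = 0" for b
    by (subst of_nat_card_sum_dec, simp)+
  \<comment> \<open>Two odd lengths 2j + 1 and 2(n - 1 - j) + 1 add up to 2n; the lost unit in the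
    index is the factor \<open>fps_X\<close>.\<close>
  have 1: "Pe = fps_X * ((S - Po) * S)"
  proof (rule fps_ext)
    fix n
    show "Pe $ n = (fps_X * ((S - Po) * S)) $ n"
    proof (cases n)
      case 0
      then show ?thesis using p0 by (simp add: defs)
    next
      case (Suc r)
      have "Pe $ n = (\<Sum>j | 2 * j + 1 < 2 * n. (?x (2 * j + 1) - ?p True (2 * j + 1)) * ?x (2 * n - (2 * j + 1)))"
        unfolding defs fps_nth_Abs_fps by (subst of_nat_card_sum_dec, subst sum_odd_reindex) (rule refl)
      also have "\<dots> = (\<Sum>j=0..r. (S $ j - Po $ j) * S $ (r - j))"
      proof (rule sum.cong)
        fix j assume "j \<in> {0..r}"
        then have "2 * n - (2 * j + 1) = 2 * (r - j) + 1" using Suc by auto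
        then show "(?x (2 * j + 1) - ?p True (2 * j + 1)) * ?x (2 * n - (2 * j + 1)) = (S $ j - Po $ j) * S $ (r - j)"
          by (simp only: S defs fps_nth_Abs_fps)
      qed (auto simp: Suc)
      also have "\<dots> = ((S - Po) * S) $ r" by (simp add: fps_mult_nth)
      finally show ?thesis using Suc by simp
    qed
  qed
  have 2: "Po = (S - Po) * T_fps"
  proof (rule fps_ext)
    fix n
    have "Po $ n = (\<Sum>j | 2 * j + 1 < 2 * n + 1. (?x (2 * j + 1) - ?p True (2 * j + 1)) * ?x (2 * n + 1 - (2 * j + 1)))"
      unfolding defs fps_nth_Abs_fps by (subst of_nat_card_sum_dec, subst sum_odd_reindex) (rule refl)
    \<comment> \<open>The added term j = n is zero since \<open>T_fps\<close> has no constant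
      term.\<close>
    also have "\<dots> = (\<Sum>j=0..n. (S $ j - Po $ j) * T_fps $ (n - j))"
      by (rule sum.mono_neutral_cong_left) (auto simp: S T defs diff_mult_distrib2)
    finally show "Po $ n = ((S - Po) * T_fps) $ n" by (simp add: fps_mult_nth)
  qed
  have 3: "Me = (T_fps - Me) * T_fps"
  proof (rule fps_ext)
    fix n
    have "Me $ n = (\<Sum>j | 1 \<le> j \<and> 2 * j < 2 * n. (?x (2 * j) - ?p False (2 * j)) * ?x (2 * n - 2 * j))"
      unfolding defs fps_nth_Abs_fps by (subst of_nat_card_sum_dec, subst sum_even_reindex) (rule refl)
    \<comment> \<open>Both added terms, j = 0 and j = n, vanish by the zero constant terms.\<close>
    also have "\<dots> = (\<Sum>j=0..n. (T_fps $ j - Me $ j) * T_fps $ (n - j))"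
      by (rule sum.mono_neutral_cong_left) (use p0 in \<open>auto simp: S T defs diff_mult_distrib2\<close>)
    finally show "Me $ n = ((T_fps - Me) * T_fps) $ n" by (simp add: fps_mult_nth)
  qed
  have 4: "Mo = (T_fps - Me) * S"
  proof (rule fps_ext)
    fix n
    have "Mo $ n = (\<Sum>j | 1 \<le> j \<and> 2 * j < 2 * n + 1. (?x (2 * j) - ?p False (2 * j)) * ?x (2 * n + 1 - 2 * j))"
      unfolding defs fps_nth_Abs_fps by (subst of_nat_card_sum_dec, subst sum_even_reindex) (rule refl)
    also have "\<dots> = (\<Sum>j=0..n. (T_fps $ j - Me $ j) * S $ (n - j))"
      by (rule sum.mono_neutral_cong_left) (use p0 in \<open>auto simp: S T defs diff_mult_distrib2 Suc_diff_le\<close>)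
    finally show "Mo $ n = ((T_fps - Me) * S) $ n" by (simp add: fps_mult_nth)
  qed
  have 5: "T_fps = Pe + Me"
  proof (rule fps_ext)
    fix n show "T_fps $ n = (Pe + Me) $ n"
      using p0 card_sep_zigzag_split[of "2 * n" True] by (cases "n = 0") (auto simp: T defs)
  qed
  \<comment> \<open>The summand 1 is the permutation of length 1, which is neither kind of
    sum.\<close>
  have 6: "S = 1 + Po + Mo"
  proof (rule fps_ext)
    fix n show "S $ n = (1 + Po + Mo) $ n"
      using p0 sep_zigzag_1[of True] card_sep_zigzag_split[of "2 * n + 1" True] by (cases "n = 0") (auto simp: S defs)
  qed
  \<comment> \<open>Write T for \<open>T_fps\<close>. By 2 and 3, (1 + T)(S - Po) = S and (1 + T)(T
    - Me) = T. Multiplying S - Po = 1 + (T - Me) S, from 4 and 6, and T - Me = x (S - Po) S, from 1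
    and 5, by 1 + T gives the two claims.\<close>
  show "S * (1 - T_fps) = 1 + T_fps" using 1 2 3 4 5 6 by algebra
  show "T_fps = fps_X * S ^ 2" using 1 2 3 4 5 6 by algebra
qed

lemma t_seq_nth: "n \<noteq> 0 \<Longrightarrow> of_nat (t_seq n) = T_fps $ n"
  by (simp add: T_fps_def)

end

theorem theorem6p2:
  shows "fps_const (1/2) * R_fps = fps_const (1/2) * R_fps * T_fps + T_fps
    \<and> t_seq 1 = 1
    \<and> (\<forall>n\<ge>2. (of_nat (t_seq n) :: rat) =
          4 / of_nat (n - 1) *
          (\<Sum>i = 0..n - 2. 2 ^ i * of_nat ((2*n - 1) choose i) * of_nat ((n - 1) choose (i + 1))))"
  including fps_syntax
proof (intro conjI allI impI)
  note S = alternating_separable_fps(1) and T = alternating_separable_fps(2)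
  have T0: "T_fps $ 0 = 0" by (simp add: T_fps_def)
  have "R_fps = R_fps * T_fps + 2 * T_fps" using S by (simp add: algebra_simps)
  then have "fps_const (1/2) * R_fps = fps_const (1/2) * R_fps * T_fps + fps_const (1/2) * 2 * T_fps"
    by (metis distrib_left mult.assoc)
  moreover have "fps_const (1/2) * 2 = (1 :: rat fps)"
    by (simp add: fps_numeral_fps_const)
  ultimately show "fps_const (1/2) * R_fps = fps_const (1/2) * R_fps * T_fps + T_fps"
    by simp
  have "of_nat (t_seq 1) = T_fps $ 1" by (rule t_seq_nth) simp
  \<comment> \<open>By T = x S^2 this coefficient is the square of the constant term 1 of S.\<close>
  also have "\<dots> = 1" by (subst T) (simp add: R_fps_def power2_eq_square)
  finally show "t_seq 1 = 1" by simp
  fix n :: nat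
  assume "2 \<le> n"
  then obtain m where m: "n = Suc (Suc m)" by (metis add_2_eq_Suc le_Suc_ex)
  then have "n - 1 = Suc m" "n - 2 = m" "2 * n - 1 = 2 * m + 3" by auto
  then show "(of_nat (t_seq n) :: rat) = 4 / of_nat (n - 1) *
      (\<Sum>i = 0..n - 2. 2 ^ i * of_nat ((2*n - 1) choose i) * of_nat ((n - 1) choose (i + 1)))"
    using t_seq_nth[of n] fps_cayley_square_fixpoint_nth[OF T0 S T, of m] m
    by (simp only: Suc_eq_plus1)
qed

end
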